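(* There are uniformly locally finite metric spaces $X$ and $Y$ with asymptotic dimension $1$ such that $\mathrm{C}^*_u(X)$ embeds into $\mathrm{C}^*_u(Y)$ by a strongly continuous rank preserving $^*$-homomorphism, but $X$ does not coarsely embed into $Y$.
   Context: A metric space $(X,d)$ is uniformly locally finite if $\sup_{x\in X}|B_r(x)|<\infty$ for all $r>0$. An operator $a\in\mathcal{B}(\ell_2(X))$ has finite propagation if there is $r>0$ with $\langle a\delta_x,\delta_y\rangle=0$ whenever $d(x,y)>r$, where $(\delta_x)_{x\in X}$ is the canonical basis. The uniform Roe algebra $\mathrm{C}^*_u(X)$ is the norm closure in $\mathcal{B}(\ell_2(X))$ of the finite propagation operators. An embedding is an injective $^*$-homomorphism (not necessarily unital). A map $\Phi\colon\mathrm{C}^*_u(X)\to\mathrm{C}^*_u(Y)$ is rank preserving if it sends minimal (i.e. rank $1$) projections to minimal (rank $1$) projections. It is strongly continuous if whenever a sequence $(a_k)_k$ in $\mathrm{C}^*_u(X)$ converges to $a\in\mathrm{C}^*_u(X)$ in the strong operator topology, $(\Phi(a_k))_k$ converges to $\Phi(a)$ in the strong operator topology. Asymptotic dimension: $\mathrm{asydim}(X)\leq n$ if for all $R>0$ there are families $\mathcal{U}_0,\ldots,\mathcal{U}_n$ of subsets of $X$ such that $X=\bigcup_{i\le n}\bigcup_{U\in\mathcal{U}_i}U$, $d(U,U')>R$ for all $i\leq n$ and distinct $U,U'\in\mathcal{U}_i$, and $\sup_{U\in\mathcal{U}_i}\mathrm{diam}(U)<\infty$ for all $i\leq n$; $\mathrm{asydim}(X)$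 is the least such $n$. A map $f\colon(X,d)\to(Y,\partial)$ is a coarse embedding if it is coarse, i.e. $\sup\{\partial(f(x),f(y))\mid d(x,y)\leq r\}<\infty$ for all $r>0$, and expanding, i.e. $\lim_{r\to\infty}\inf\{\partial(f(x),f(y))\mid d(x,y)\geq r\}=\infty$. *)

theory Defs
  imports "HOL-Analysis.Analysis" "HOL-Library.Extended_Nat"
begin

section \<open>Metric spaces and coarse geometry\<close>

definition uniformly_locally_finite :: "'a metric \<Rightarrow> bool" where
  "uniformly_locally_finite X \<longleftrightarrow>
     (\<forall>r>0. \<exists>N. \<forall>x\<in>mspace X. finite (mcball_of X x r) \<and> card (mcball_of X x r) \<le> N)"

text \<open>Distances between sets, diameters, and the suprema and infima below are taken in
  \<^typ>\<open>ennreal\<close>, so that an infimum over the empty set is infinite and a supremum over the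
  empty set is zero.\<close>

definition set_distance :: "'a metric \<Rightarrow> 'a set \<Rightarrow> 'a set \<Rightarrow> ennreal" where
  "set_distance X U V = (INF x\<in>U. INF y\<in>V. ennreal (mdist X x y))"

definition set_diameter :: "'a metric \<Rightarrow> 'a set \<Rightarrow> ennreal" where
  "set_diameter X U = (SUP x\<in>U. SUP y\<in>U. ennreal (mdist X x y))"

definition asydim_le :: "'a metric \<Rightarrow> nat \<Rightarrow> bool" where
  "asydim_le X n \<longleftrightarrow>
     (\<forall>R::real>0. \<exists>\<U> :: nat \<Rightarrow> 'a set set.
        (\<forall>i\<le>n. \<forall>U\<in>\<U> i. U \<subseteq> mspace X) \<and>
        mspace X = (\<Union>i\<le>n. \<Union>U\<in>\<U> i. U) \<and>
        (\<forall>i\<le>n. \<forall>U\<in>\<U> i. \<forall>V\<in>\<U> i. U \<noteq> V \<longrightarrow> set_distance X U V > ennreal R) \<and>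
        (\<forall>i\<le>n. (SUP U\<in>\<U> i. set_diameter X U) < \<infinity>))"

definition asydim :: "'a metric \<Rightarrow> enat" where
  "asydim X = Inf {enat n |n. asydim_le X n}"

definition coarse_map :: "'a metric \<Rightarrow> 'b metric \<Rightarrow> ('a \<Rightarrow> 'b) \<Rightarrow> bool" where
  "coarse_map X Y f \<longleftrightarrow>
     (\<forall>r::real>0. (SUP (x, y) \<in> {(x, y). x \<in> mspace X \<and> y \<in> mspace X \<and> mdist X x y \<le> r}.
        ennreal (mdist Y (f x) (f y))) < \<infinity>)"

definition expanding_map :: "'a metric \<Rightarrow> 'b metric \<Rightarrow> ('a \<Rightarrow> 'b) \<Rightarrow> bool" where
  "expanding_map X Y f \<longleftrightarrow>
     ((\<lambda>r::real. INF (x, y) \<in> {(x, y). x \<in> mspace X \<and> y \<in> mspace X \<and> mdist X x y \<ge> r}.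
        ennreal (mdist Y (f x) (f y))) \<longlongrightarrow> \<infinity>) at_top"

definition coarse_embedding :: "'a metric \<Rightarrow> 'b metric \<Rightarrow> ('a \<Rightarrow> 'b) \<Rightarrow> bool" where
  "coarse_embedding X Y f \<longleftrightarrow>
     f \<in> mspace X \<rightarrow> mspace Y \<and> coarse_map X Y f \<and> expanding_map X Y f"


section \<open>The complex Hilbert space of square-summable families\<close>

typedef 'a ell2 = "{f :: 'a \<Rightarrow> complex. (\<lambda>x. (cmod (f x))\<^sup>2) summable_on UNIV}"
  morphisms ell2_nth Abs_ell2
  by (rule exI[of _ "\<lambda>_. 0"]) simp

setup_lifting type_definition_ell2

lemma ell2_add_summable:
  fixes f g :: "'a \<Rightarrow> complex"
  assumes "(\<lambda>x. (cmod (f x))\<^sup>2) summable_on UNIV" "(\<lambda>x. (cmod (g x))\<^sup>2) summable_on UNIV"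
  shows "(\<lambda>x. (cmod (f x + g x))\<^sup>2) summable_on UNIV"
proof (rule summable_on_comparison_test)
  show "(\<lambda>x. 2 * (cmod (f x))\<^sup>2 + 2 * (cmod (g x))\<^sup>2) summable_on UNIV"
    by (intro summable_on_add summable_on_cmult_right assms)
  fix x
  have "(cmod (f x + g x))\<^sup>2 \<le> (cmod (f x) + cmod (g x))\<^sup>2"
    by (intro power_mono norm_triangle_ineq) auto
  also have "\<dots> \<le> 2 * (cmod (f x))\<^sup>2 + 2 * (cmod (g x))\<^sup>2"
    using zero_le_power2[of "cmod (f x) - cmod (g x)"]
    by (simp add: power2_eq_square algebra_simps)
  finally show "(cmod (f x + g x))\<^sup>2 \<le> 2 * (cmod (f x))\<^sup>2 + 2 * (cmod (g x))\<^sup>2" .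
qed auto

lemma ell2_scale_summable:
  fixes f :: "'a \<Rightarrow> complex"
  assumes "(\<lambda>x. (cmod (f x))\<^sup>2) summable_on UNIV"
  shows "(\<lambda>x. (cmod (c * f x))\<^sup>2) summable_on UNIV"
  by (simp add: norm_mult power_mult_distrib summable_on_cmult_right assms)

lemma ell2_mult_summable:
  fixes f g :: "'a \<Rightarrow> complex"
  assumes "(\<lambda>x. (cmod (f x))\<^sup>2) summable_on UNIV" "(\<lambda>x. (cmod (g x))\<^sup>2) summable_on UNIV"
  shows "(\<lambda>x. f x * cnj (g x)) summable_on UNIV"
proof (rule abs_summable_summable, rule summable_on_comparison_test)
  show "(\<lambda>x. (cmod (f x))\<^sup>2 + (cmod (g x))\<^sup>2) summable_on UNIV"
    by (intro summable_on_add assms)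
  fix x
  have "2 * (cmod (f x) * cmod (g x)) \<le> (cmod (f x))\<^sup>2 + (cmod (g x))\<^sup>2"
    using zero_le_power2[of "cmod (f x) - cmod (g x)"]
    by (simp add: power2_eq_square algebra_simps)
  moreover have "0 \<le> cmod (f x) * cmod (g x)" by simp
  ultimately show "norm (f x * cnj (g x)) \<le> (cmod (f x))\<^sup>2 + (cmod (g x))\<^sup>2"
    unfolding norm_mult complex_mod_cnj by linarith
qed auto

lift_definition cinner :: "'a ell2 \<Rightarrow> 'a ell2 \<Rightarrow> complex" is
  "\<lambda>f g. \<Sum>\<^sub>\<infinity>x. f x * cnj (g x)" .

lift_definition scaleC :: "complex \<Rightarrow> 'a ell2 \<Rightarrow> 'a ell2" is "\<lambda>c f x. c * f x"
  by (simp add: ell2_scale_summable)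

lift_definition basis_vec :: "'a \<Rightarrow> 'a ell2" is "\<lambda>x y. if y = x then 1 else 0"
proof -
  fix x :: 'a
  have "(\<lambda>y. (cmod (if y = x then 1 else 0))\<^sup>2) summable_on UNIV \<longleftrightarrow>
        (\<lambda>y. (cmod (if y = x then 1 else 0))\<^sup>2) summable_on {x}"
    by (rule summable_on_cong_neutral) auto
  then show "(\<lambda>y. (cmod (if y = x then 1 else 0))\<^sup>2) summable_on UNIV"
    by simp
qed

instantiation ell2 :: (type) real_inner
begin

lift_definition zero_ell2 :: "'a ell2" is "\<lambda>_. 0" by simp
lift_definition plus_ell2 :: "'a ell2 \<Rightarrow> 'a ell2 \<Rightarrow> 'a ell2" is "\<lambda>f g x. f x + g x"
  by (simp add: ell2_add_summable)
lift_definition uminus_ell2 :: "'a ell2 \<Rightarrow> 'a ell2" is "\<lambda>f x. - f x" by simp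
lift_definition minus_ell2 :: "'a ell2 \<Rightarrow> 'a ell2 \<Rightarrow> 'a ell2" is "\<lambda>f g x. f x - g x"
proof -
  fix f g :: "'a \<Rightarrow> complex"
  assume "(\<lambda>x. (cmod (f x))\<^sup>2) summable_on UNIV" "(\<lambda>x. (cmod (g x))\<^sup>2) summable_on UNIV"
  then show "(\<lambda>x. (cmod (f x - g x))\<^sup>2) summable_on UNIV"
    using ell2_add_summable[of f "\<lambda>x. - g x"] by simp
qed
definition scaleR_ell2 :: "real \<Rightarrow> 'a ell2 \<Rightarrow> 'a ell2" where
  "scaleR_ell2 r = scaleC (of_real r)"
definition inner_ell2 :: "'a ell2 \<Rightarrow> 'a ell2 \<Rightarrow> real" where
  "inner_ell2 \<xi> \<eta> = Re (cinner \<xi> \<eta>)"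
definition norm_ell2 :: "'a ell2 \<Rightarrow> real" where
  "norm_ell2 \<xi> = sqrt (inner \<xi> \<xi>)"
definition sgn_ell2 :: "'a ell2 \<Rightarrow> 'a ell2" where
  "sgn_ell2 \<xi> = inverse (norm \<xi>) *\<^sub>R \<xi>"
definition dist_ell2 :: "'a ell2 \<Rightarrow> 'a ell2 \<Rightarrow> real" where
  "dist_ell2 \<xi> \<eta> = norm (\<xi> - \<eta>)"
definition uniformity_ell2 :: "('a ell2 \<times> 'a ell2) filter" where
  "uniformity_ell2 = (INF e\<in>{0 <..}. principal {(\<xi>, \<eta>). dist \<xi> \<eta> < e})"
definition open_ell2 :: "'a ell2 set \<Rightarrow> bool" where
  "open_ell2 S \<longleftrightarrow> (\<forall>\<xi>\<in>S. \<forall>\<^sub>F (\<xi>', \<eta>) in uniformity. \<xi>' = \<xi> \<longrightarrow> \<eta> \<in> S)"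

instance
proof
  fix a b c :: "'a ell2" and r s :: real
  show "a + b + c = a + (b + c)" by transfer (simp add: add.assoc)
  show "a + b = b + a" by transfer (simp add: add.commute)
  show "0 + a = a" by transfer simp
  show "- a + a = 0" by transfer simp
  show "a - b = a + - b" by transfer simp
  show "r *\<^sub>R (a + b) = r *\<^sub>R a + r *\<^sub>R b"
    unfolding scaleR_ell2_def by transfer (simp add: ring_distribs)
  show "(r + s) *\<^sub>R a = r *\<^sub>R a + s *\<^sub>R a"
    unfolding scaleR_ell2_def by transfer (simp add: ring_distribs)
  show "r *\<^sub>R s *\<^sub>R a = (r * s) *\<^sub>R a"
    unfolding scaleR_ell2_def by transfer (simp add: mult.assoc)
  show "1 *\<^sub>R a = a"
    unfolding scaleR_ell2_def by transfer simp
  show "dist a b = norm (a - b)" by (rule dist_ell2_def)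
  show "sgn a = inverse (norm a) *\<^sub>R a" by (rule sgn_ell2_def)
  show "uniformity = (INF e\<in>{0 <..}. principal {(x :: 'a ell2, y). dist x y < e})"
    by (rule uniformity_ell2_def)
  show "open S \<longleftrightarrow> (\<forall>x\<in>S. \<forall>\<^sub>F (x', y) in uniformity. x' = x \<longrightarrow> y \<in> S)" for S :: "'a ell2 set"
    by (rule open_ell2_def)
  show "inner a b = inner b a"
    unfolding inner_ell2_def
  proof transfer
    fix f g :: "'a \<Rightarrow> complex"
    have "(\<Sum>\<^sub>\<infinity>x. g x * cnj (f x)) = cnj (\<Sum>\<^sub>\<infinity>x. f x * cnj (g x))"
      unfolding infsum_cnj[symmetric] by (rule infsum_cong) simp
    then show "Re (\<Sum>\<^sub>\<infinity>x. f x * cnj (g x)) = Re (\<Sum>\<^sub>\<infinity>x. g x * cnj (f x))" by simp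
  qed
  show "inner (a + b) c = inner a c + inner b c"
    unfolding inner_ell2_def
    by transfer (simp add: ring_distribs infsum_add ell2_mult_summable)
  show "inner (r *\<^sub>R a) b = r * inner a b"
    unfolding inner_ell2_def scaleR_ell2_def
    by transfer (simp add: mult.assoc infsum_cmult_right')
  have sq: "Re (\<Sum>\<^sub>\<infinity>x. f x * cnj (f x)) = (\<Sum>\<^sub>\<infinity>x. (cmod (f x))\<^sup>2)"
    if "(\<lambda>x. (cmod (f x))\<^sup>2) summable_on UNIV" for f :: "'a \<Rightarrow> complex"
  proof -
    have "Re (f x * cnj (f x)) = (cmod (f x))\<^sup>2" for x
      by (simp only: complex_norm_square[symmetric] Re_complex_of_real)
    then show ?thesis
      unfolding infsum_Re[OF ell2_mult_summable[OF that that], symmetric] by (simp only:)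
  qed
  show "0 \<le> inner a a"
    unfolding inner_ell2_def by transfer (simp add: sq infsum_nonneg)
  show "inner a a = 0 \<longleftrightarrow> a = 0"
    unfolding inner_ell2_def
  proof transfer
    fix f :: "'a \<Rightarrow> complex"
    assume f: "(\<lambda>x. (cmod (f x))\<^sup>2) summable_on UNIV"
    have "f = (\<lambda>_. 0)" if "(\<Sum>\<^sub>\<infinity>x. (cmod (f x))\<^sup>2) = 0"
    proof
      show "f x = 0" for x
        using nonneg_infsum_le_0D[of "\<lambda>x. (cmod (f x))\<^sup>2" UNIV x] f that by simp
    qed
    moreover have "(\<Sum>\<^sub>\<infinity>x. (cmod (f x))\<^sup>2) = 0" if "f = (\<lambda>_. 0)"
      using that by simp
    ultimately show "Re (\<Sum>\<^sub>\<infinity>x. f x * cnj (f x)) = 0 \<longleftrightarrow> f = (\<lambda>_. 0)"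
      unfolding sq[OF f] by blast
  qed
  show "norm a = sqrt (inner a a)" by (rule norm_ell2_def)
qed

end

lift_definition scalar_op :: "complex \<Rightarrow> 'a ell2 \<Rightarrow>\<^sub>L 'a ell2" is "scaleC"
proof -
  fix c :: complex
  have n: "norm (scaleC c \<xi>) = cmod c * norm \<xi>" for \<xi> :: "'a ell2"
  proof -
    have "cinner (scaleC c \<xi>) (scaleC c \<xi>) = c * cnj c * cinner \<xi> \<xi>"
      by transfer (simp add: mult_ac flip: infsum_cmult_right')
    then have "inner (scaleC c \<xi>) (scaleC c \<xi>) = (cmod c)\<^sup>2 * inner \<xi> \<xi>"
      unfolding inner_ell2_def complex_norm_square[symmetric] by simp
    then show ?thesis by (simp add: norm_eq_sqrt_inner real_sqrt_mult)
  qed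
  show "bounded_linear (scaleC c :: 'a ell2 \<Rightarrow> 'a ell2)"
  proof (rule bounded_linear_intro[of _ "cmod c"])
    show "scaleC c (\<xi> + \<eta>) = scaleC c \<xi> + scaleC c \<eta>" for \<xi> \<eta> :: "'a ell2"
      by transfer (simp add: ring_distribs)
    show "scaleC c (r *\<^sub>R \<xi>) = r *\<^sub>R scaleC c \<xi>" for r and \<xi> :: "'a ell2"
      unfolding scaleR_ell2_def by transfer (simp add: mult_ac)
    show "norm (scaleC c \<xi>) \<le> norm \<xi> * cmod c" for \<xi> :: "'a ell2"
      by (simp add: n mult.commute)
  qed
qed


section \<open>Uniform Roe algebras\<close>

text \<open>The type \<^typ>\<open>'a ell2 \<Rightarrow>\<^sub>L 'a ell2\<close> consists of the bounded \<^emph>\<open>real\<close>-linear operators, so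
  complex linearity is imposed. For a metric space \<open>X\<close> with carrier \<open>mspace X\<close>, the Hilbert
  space \<open>\<ell>\<^sub>2(X)\<close> is the closed subspace of vectors vanishing off the carrier, and an operator on
  it is identified with its extension by zero on the orthogonal complement. The norm, products,
  adjoints, and strong convergence of operators on \<open>\<ell>\<^sub>2(X)\<close> are unchanged by this extension.\<close>

definition bounded_ops :: "'a metric \<Rightarrow> ('a ell2 \<Rightarrow>\<^sub>L 'a ell2) set" where
  "bounded_ops X = {a.
     (\<forall>c \<xi>. blinfun_apply a (scaleC c \<xi>) = scaleC c (blinfun_apply a \<xi>)) \<and>
     (\<forall>\<xi> x. x \<notin> mspace X \<longrightarrow> ell2_nth (blinfun_apply a \<xi>) x = 0) \<and>
     (\<forall>\<xi>. (\<forall>x\<in>mspace X. ell2_nth \<xi> x = 0) \<longrightarrow> blinfun_apply a \<xi> = 0)}"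

definition finite_propagation :: "'a metric \<Rightarrow> ('a ell2 \<Rightarrow>\<^sub>L 'a ell2) \<Rightarrow> bool" where
  "finite_propagation X a \<longleftrightarrow>
     (\<exists>r>0. \<forall>x\<in>mspace X. \<forall>y\<in>mspace X. mdist X x y > r \<longrightarrow>
        cinner (blinfun_apply a (basis_vec x)) (basis_vec y) = 0)"

text \<open>Since \<^term>\<open>bounded_ops X\<close> is norm closed, the closure below is the closure in
  \<open>B(\<ell>\<^sub>2(X))\<close>.\<close>

definition uniform_Roe :: "'a metric \<Rightarrow> ('a ell2 \<Rightarrow>\<^sub>L 'a ell2) set" where
  "uniform_Roe X = closure {a \<in> bounded_ops X. finite_propagation X a}"

definition adjoint_op :: "('a ell2 \<Rightarrow>\<^sub>L 'a ell2) \<Rightarrow> ('a ell2 \<Rightarrow>\<^sub>L 'a ell2)" where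
  "adjoint_op a =
     (THE b. \<forall>\<xi> \<eta>. cinner (blinfun_apply a \<xi>) \<eta> = cinner \<xi> (blinfun_apply b \<eta>))"

definition star_hom_on ::
  "('a ell2 \<Rightarrow>\<^sub>L 'a ell2) set \<Rightarrow> ('b ell2 \<Rightarrow>\<^sub>L 'b ell2) set \<Rightarrow>
     (('a ell2 \<Rightarrow>\<^sub>L 'a ell2) \<Rightarrow> ('b ell2 \<Rightarrow>\<^sub>L 'b ell2)) \<Rightarrow> bool" where
  "star_hom_on A B \<Phi> \<longleftrightarrow>
     \<Phi> \<in> A \<rightarrow> B \<and>
     (\<forall>a\<in>A. \<forall>b\<in>A. \<Phi> (a + b) = \<Phi> a + \<Phi> b) \<and>
     (\<forall>c. \<forall>a\<in>A. \<Phi> (scalar_op c o\<^sub>L a) = scalar_op c o\<^sub>L \<Phi> a) \<and>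
     (\<forall>a\<in>A. \<forall>b\<in>A. \<Phi> (a o\<^sub>L b) = \<Phi> a o\<^sub>L \<Phi> b) \<and>
     (\<forall>a\<in>A. \<Phi> (adjoint_op a) = adjoint_op (\<Phi> a))"

definition Roe_embedding ::
  "'a metric \<Rightarrow> 'b metric \<Rightarrow> (('a ell2 \<Rightarrow>\<^sub>L 'a ell2) \<Rightarrow> ('b ell2 \<Rightarrow>\<^sub>L 'b ell2)) \<Rightarrow> bool" where
  "Roe_embedding X Y \<Phi> \<longleftrightarrow>
     star_hom_on (uniform_Roe X) (uniform_Roe Y) \<Phi> \<and> inj_on \<Phi> (uniform_Roe X)"

definition rank_one_projection :: "('a ell2 \<Rightarrow>\<^sub>L 'a ell2) \<Rightarrow> bool" where
  "rank_one_projection p \<longleftrightarrow>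
     p o\<^sub>L p = p \<and> adjoint_op p = p \<and>
     (\<exists>\<xi>. \<xi> \<noteq> 0 \<and> range (blinfun_apply p) = range (\<lambda>c. scaleC c \<xi>))"

definition rank_preserving ::
  "'a metric \<Rightarrow> (('a ell2 \<Rightarrow>\<^sub>L 'a ell2) \<Rightarrow> ('b ell2 \<Rightarrow>\<^sub>L 'b ell2)) \<Rightarrow> bool" where
  "rank_preserving X \<Phi> \<longleftrightarrow>
     (\<forall>p\<in>uniform_Roe X. rank_one_projection p \<longrightarrow> rank_one_projection (\<Phi> p))"

definition SOT_converges ::
  "(nat \<Rightarrow> ('a ell2 \<Rightarrow>\<^sub>L 'a ell2)) \<Rightarrow> ('a ell2 \<Rightarrow>\<^sub>L 'a ell2) \<Rightarrow> bool" where
  "SOT_converges s a \<longleftrightarrow>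
     (\<forall>\<xi>. (\<lambda>k. blinfun_apply (s k) \<xi>) \<longlonglongrightarrow> blinfun_apply a \<xi>)"

definition strongly_continuous ::
  "'a metric \<Rightarrow> (('a ell2 \<Rightarrow>\<^sub>L 'a ell2) \<Rightarrow> ('b ell2 \<Rightarrow>\<^sub>L 'b ell2)) \<Rightarrow> bool" where
  "strongly_continuous X \<Phi> \<longleftrightarrow>
     (\<forall>s a. (\<forall>k. s k \<in> uniform_Roe X) \<and> a \<in> uniform_Roe X \<and> SOT_converges s a \<longrightarrow>
        SOT_converges (\<lambda>k. \<Phi> (s k)) (\<Phi> a))"

end

theory Submission
  imports Defs
begin

text \<open>Take for \<open>X\<close> the integers and for \<open>Y\<close> the natural numbers, both with the usual distance.
  Listing the integers as \<open>0, -1, 1, -2, 2, \<dots>\<close> folds the line \<open>X\<close> onto the half-line \<open>Y\<close>. This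
  bijection at most doubles distances up to an additive constant, so it is coarse, and conjugation
  by the unitary operator that it induces between the \<open>\<ell>\<^sub>2\<close> spaces turns operators of finite
  propagation on \<open>X\<close> into operators of finite propagation on \<open>Y\<close>. Being implemented by a unitary,
  this conjugation is a strongly continuous rank preserving embedding. Transporting the metric of
  the integers along the listing makes the folding map the identity on the natural numbers:
  \<open>X\<close> and \<open>Y\<close> are then two metrics on one set, the uniform Roe algebra of the first is a
  subset of that of the second (\<open>uniform_Roe_mono\<close>), and the embedding is the inclusion.

  No coarse embedding exists because a line cannot be put into a half-line without the two ends
  running alongside each other (\<open>no_coarse_embedding_line_into_half_line\<close>): a coarse map has jumps
  of at most some \<open>L\<close>, and an expanding map sends both ends of \<open>X\<close> to infinity. For each large
  \<open>v\<close>, both ends therefore hit the window between \<open>v\<close> and \<open>v + L\<close>, at points that lie far apart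
  in \<open>X\<close> while their images are less than \<open>L\<close> apart.

  Both spaces have asymptotic dimension one: cutting the line into long blocks and sorting these
  by parity gives the two families of the upper bound, and the dimension is not zero since an
  unbounded walk with steps of bounded length stays within one member of a sufficiently separated
  family.\<close>

section \<open>Coarse maps and uniform Roe algebras\<close>

lemma coarse_map_iff:
  "coarse_map X Y f \<longleftrightarrow>
     (\<forall>r>0. \<exists>C. \<forall>x\<in>mspace X. \<forall>y\<in>mspace X. mdist X x y \<le> r \<longrightarrow> mdist Y (f x) (f y) \<le> C)"
    (is "_ \<longleftrightarrow> (\<forall>r>0. ?bounded r)")
proof -
  have "(SUP (x, y) \<in> {(x, y). x \<in> mspace X \<and> y \<in> mspace X \<and> mdist X x y \<le> r}.
        ennreal (mdist Y (f x) (f y))) < \<infinity> \<longleftrightarrow> ?bounded r" (is "?S < \<infinity> \<longleftrightarrow> _") for r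
  proof
    assume fin: "?S < \<infinity>"
    have "mdist Y (f x) (f y) \<le> enn2real ?S"
      if "x \<in> mspace X" "y \<in> mspace X" "mdist X x y \<le> r" for x y
    proof -
      have "ennreal (mdist Y (f x) (f y)) \<le> ?S"
        using that by (intro SUP_upper2[of "(x, y)"]) auto
      then have "enn2real (ennreal (mdist Y (f x) (f y))) \<le> enn2real ?S"
        using fin by (intro enn2real_mono) auto
      then show ?thesis by simp
    qed
    then show "?bounded r" by blast
  next
    assume "?bounded r"
    then obtain C where C: "\<forall>x\<in>mspace X. \<forall>y\<in>mspace X. mdist X x y \<le> r \<longrightarrow> mdist Y (f x) (f y) \<le> C"
      by blast
    have "?S \<le> ennreal C"
      by (rule SUP_least) (use C in \<open>auto intro!: ennreal_leI\<close>)
    then show "?S < \<infinity>"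
      using le_less_trans[OF _ ennreal_less_top] by auto
  qed
  then show ?thesis unfolding coarse_map_def by simp
qed

lemma expanding_mapD:
  assumes "expanding_map X Y f"
  obtains s :: nat where
    "\<And>x y. \<lbrakk>x \<in> mspace X; y \<in> mspace X; mdist X x y \<ge> real s\<rbrakk> \<Longrightarrow> mdist Y (f x) (f y) > C"
proof -
  let ?I = "\<lambda>r::real. INF (x, y) \<in> {(x, y). x \<in> mspace X \<and> y \<in> mspace X \<and> mdist X x y \<ge> r}.
        ennreal (mdist Y (f x) (f y))"
  have "\<forall>\<^sub>F r in at_top. ennreal C < ?I r"
    using assms unfolding expanding_map_def by (rule order_tendstoD) simp
  then obtain r where r: "ennreal C < ?I r'" if "r' \<ge> r" for r'
    unfolding eventually_at_top_linorder by blast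
  define s where "s = nat \<lceil>r\<rceil>"
  show thesis
  proof (rule that)
    fix x y assume xy: "x \<in> mspace X" "y \<in> mspace X" "mdist X x y \<ge> real s"
    have "ennreal C < ?I (real s)"
      by (rule r) (unfold s_def, linarith)
    also have "\<dots> \<le> ennreal (mdist Y (f x) (f y))"
      using xy by (intro INF_lower2[of "(x, y)"]) auto
    finally show "C < mdist Y (f x) (f y)"
      by (rule contrapos_pp) (simp add: ennreal_leI not_less)
  qed
qed

text \<open>A bijective coarse map does not increase propagation beyond control. With both metrics on
  the same carrier the two \<open>\<ell>\<^sub>2\<close> spaces coincide, so the resulting embedding of Roe algebras is
  an inclusion.\<close>

lemma uniform_Roe_mono:
  assumes carrier: "mspace X = mspace Y" and coarse: "coarse_map X Y id"
  shows "uniform_Roe X \<subseteq> uniform_Roe Y"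
proof -
  have ops: "bounded_ops X = bounded_ops Y"
    unfolding bounded_ops_def carrier ..
  have "finite_propagation Y a" if fp: "finite_propagation X a" for a
  proof -
    obtain r where r: "r > 0"
      "\<forall>x\<in>mspace X. \<forall>y\<in>mspace X. mdist X x y > r \<longrightarrow>
         cinner (blinfun_apply a (basis_vec x)) (basis_vec y) = 0"
      using fp unfolding finite_propagation_def by blast
    obtain C where C: "\<forall>x\<in>mspace X. \<forall>y\<in>mspace X. mdist X x y \<le> r \<longrightarrow> mdist Y x y \<le> C"
      using coarse \<open>r > 0\<close> unfolding coarse_map_iff by fastforce
    have "cinner (blinfun_apply a (basis_vec x)) (basis_vec y) = 0"
      if "x \<in> mspace Y" "y \<in> mspace Y" "mdist Y x y > max C 1" for x y
      using that r(2) C carrier by force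
    then show ?thesis
      unfolding finite_propagation_def by (intro exI[of _ "max C 1"]) auto
  qed
  then show ?thesis
    unfolding uniform_Roe_def ops by (intro closure_mono) auto
qed

corollary Roe_embedding_id:
  assumes "mspace X = mspace Y" "coarse_map X Y id"
  shows "Roe_embedding X Y id"
  using uniform_Roe_mono[OF assms] by (auto simp: Roe_embedding_def star_hom_on_def)

section \<open>Asymptotic dimension\<close>

text \<open>A walk whose steps have length at most \<open>c\<close> cannot leave a member of a \<open>c\<close>-separated
  cover, so an unbounded walk forces that member to be unbounded.\<close>

lemma unbounded_walk_not_asydim_le_0:
  fixes w :: "nat \<Rightarrow> 'a"
  assumes w: "\<And>n. w n \<in> mspace X"
    and step: "c > 0" "\<And>n. mdist X (w n) (w (Suc n)) \<le> c"
    and unbounded: "\<And>C. \<exists>n. mdist X (w 0) (w n) > C"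
  shows "\<not> asydim_le X 0"
proof
  assume "asydim_le X 0"
  then obtain \<U> :: "nat \<Rightarrow> 'a set set" where cover: "mspace X = \<Union> (\<U> 0)"
    and sep: "\<And>U V. \<lbrakk>U \<in> \<U> 0; V \<in> \<U> 0; U \<noteq> V\<rbrakk> \<Longrightarrow> set_distance X U V > ennreal c"
    and diam: "(SUP U\<in>\<U> 0. set_diameter X U) < \<infinity>"
    unfolding asydim_le_def using \<open>c > 0\<close> by (auto dest!: spec[of _ c])
  obtain U where U: "U \<in> \<U> 0" "w 0 \<in> U"
    using w[of 0] cover by auto
  have wU: "w n \<in> U" for n
  proof (induction n)
    case (Suc n)
    obtain V where V: "V \<in> \<U> 0" "w (Suc n) \<in> V"
      using w[of "Suc n"] cover by auto
    have "set_distance X U V \<le> ennreal (mdist X (w n) (w (Suc n)))"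
      unfolding set_distance_def using Suc V by (meson INF_lower2 order_refl)
    also have "\<dots> \<le> ennreal c"
      by (intro ennreal_leI step)
    finally show ?case
      using sep[OF U(1) V(1)] V(2) by (cases "U = V") auto
  qed (use U in auto)
  define D where "D = (SUP U\<in>\<U> 0. set_diameter X U)"
  obtain n where n: "mdist X (w 0) (w n) > enn2real D"
    using unbounded by blast
  have "ennreal (mdist X (w 0) (w n)) \<le> set_diameter X U"
    unfolding set_diameter_def using wU by (meson SUP_upper2 order_refl)
  also have "\<dots> \<le> D"
    unfolding D_def using U(1) by (rule SUP_upper)
  finally have "enn2real (ennreal (mdist X (w 0) (w n))) \<le> enn2real D"
    using diam unfolding D_def by (intro enn2real_mono) auto
  with n show False by simp
qed

lemma asydim_eq_1I:
  assumes "asydim_le X 1" "\<not> asydim_le X 0"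
  shows "asydim X = 1"
  unfolding asydim_def
proof (rule antisym)
  show "Inf {enat n |n. asydim_le X n} \<le> 1"
    using assms(1) by (intro Inf_lower) (auto simp: one_enat_def)
  have "1 \<le> enat n" if "asydim_le X n" for n
    using that assms(2) by (cases n) (auto simp: one_enat_def)
  then show "1 \<le> Inf {enat n |n. asydim_le X n}"
    by (intro Inf_greatest) auto
qed

section \<open>Subsets of the integer line\<close>

definition line_metric :: "('a \<Rightarrow> int) \<Rightarrow> 'a metric" where
  "line_metric e = metric (UNIV, \<lambda>x y. real_of_int \<bar>e x - e y\<bar>)"

lemma
  assumes "inj e"
  shows mspace_line_metric: "mspace (line_metric e) = UNIV"
    and mdist_line_metric: "mdist (line_metric e) x y = real_of_int \<bar>e x - e y\<bar>"
proof -
  interpret Metric_space UNIV "\<lambda>x y. real_of_int \<bar>e x - e y\<bar>"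
    by standard (use injD[OF assms] in auto)
  show "mspace (line_metric e) = UNIV" "mdist (line_metric e) x y = real_of_int \<bar>e x - e y\<bar>"
    unfolding line_metric_def by (rule mspace_metric, simp only: mdist_metric)
qed

lemma uniformly_locally_finite_line_metric:
  assumes "inj e"
  shows "uniformly_locally_finite (line_metric e)"
  unfolding uniformly_locally_finite_def
proof (intro allI impI)
  fix r :: real
  have "finite (mcball_of (line_metric e) x r) \<and>
        card (mcball_of (line_metric e) x r) \<le> nat (2 * \<lfloor>r\<rfloor> + 1)" for x
  proof -
    let ?B = "mcball_of (line_metric e) x r"
    have sub: "e ` ?B \<subseteq> {e x - \<lfloor>r\<rfloor>..e x + \<lfloor>r\<rfloor>}"
    proof
      fix i assume "i \<in> e ` ?B"
      then have "real_of_int \<bar>e x - i\<bar> \<le> r"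
        using assms by (auto simp: mdist_line_metric)
      then have "\<bar>e x - i\<bar> \<le> \<lfloor>r\<rfloor>"
        by (simp only: le_floor_iff)
      then show "i \<in> {e x - \<lfloor>r\<rfloor>..e x + \<lfloor>r\<rfloor>}" by auto
    qed
    have inj: "inj_on e ?B"
      using assms by (rule inj_on_subset) simp
    have "finite ?B"
      using finite_imageD[OF finite_subset[OF sub] inj] by simp
    moreover have "card ?B \<le> card {e x - \<lfloor>r\<rfloor>..e x + \<lfloor>r\<rfloor>}"
      using inj sub by (rule card_inj_on_le) simp
    ultimately show ?thesis by (simp add: algebra_simps)
  qed
  then show "\<exists>N. \<forall>x\<in>mspace (line_metric e).
      finite (mcball_of (line_metric e) x r) \<and> card (mcball_of (line_metric e) x r) \<le> N"
    by blast
qed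

lemma asydim_le_1_line_metric:
  fixes e :: "'a \<Rightarrow> int"
  assumes "inj e"
  shows "asydim_le (line_metric e) 1"
  unfolding asydim_le_def
proof (intro allI impI)
  fix R :: real assume "R > 0"
  define N where "N = \<lceil>R\<rceil>"
  have N: "N > 0" "R \<le> N"
    using \<open>R > 0\<close> unfolding N_def by linarith+
  define block where "block k = {x. e x div N = k}" for k
  define \<U> where "\<U> i = range (\<lambda>k. block (2 * k + int i))" for i :: nat
  have dm: "e x = N * (e x div N) + e x mod N" "0 \<le> e x mod N" "e x mod N < N" for x
    using N by auto
  have far: "real_of_int \<bar>e x - e y\<bar> \<ge> N + 1" if "e x div N \<ge> e y div N + 2" for x y
  proof -
    have "N * (e x div N) \<ge> N * (e y div N) + 2 * N"
      using mult_left_mono[OF that, of N] N by (simp add: algebra_simps)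
    then have "\<bar>e x - e y\<bar> \<ge> N + 1"
      using dm[of x] dm[of y] by linarith
    then show ?thesis by linarith
  qed
  have sep: "set_distance (line_metric e) U V > ennreal R"
    if UV: "U \<in> \<U> i" "V \<in> \<U> i" "U \<noteq> V" for i U V
  proof -
    obtain k l where kl: "U = block (2 * k + int i)" "V = block (2 * l + int i)" "k \<noteq> l"
      using UV unfolding \<U>_def by auto
    have "mdist (line_metric e) x y \<ge> N + 1" if "x \<in> U" "y \<in> V" for x y
    proof -
      have "e x div N \<ge> e y div N + 2 \<or> e y div N \<ge> e x div N + 2"
        using that kl unfolding block_def by auto
      then show ?thesis
        using far[of x y] far[of y x] assms by (auto simp: mdist_line_metric abs_minus_commute)
    qed
    then have "ennreal (N + 1) \<le> set_distance (line_metric e) U V"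
      unfolding set_distance_def by (intro INF_greatest ennreal_leI) auto
    moreover have "ennreal R < ennreal (N + 1)"
      using \<open>R > 0\<close> N by (intro ennreal_lessI) linarith+
    ultimately show ?thesis by order
  qed
  have diam: "(SUP U\<in>\<U> i. set_diameter (line_metric e) U) < \<infinity>" for i
  proof -
    have "mdist (line_metric e) x y \<le> N" if "x \<in> block k" "y \<in> block k" for x y k
    proof -
      have "e x div N = e y div N"
        using that unfolding block_def by simp
      then have "\<bar>e x - e y\<bar> \<le> N"
        using dm[of x] dm[of y] by (metis abs_diff_le_iff add_diff_cancel_left abs_le_iff
            diff_left_mono diff_mono diff_zero less_imp_le minus_diff_eq order_trans)
      then show ?thesis
        using assms by (simp add: mdist_line_metric)
    qed
    then have "(SUP U\<in>\<U> i. set_diameter (line_metric e) U) \<le> ennreal N"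
      unfolding set_diameter_def \<U>_def by (intro SUP_least ennreal_leI) auto
    then show ?thesis
      using le_less_trans[OF _ ennreal_less_top] by auto
  qed
  have cover: "(\<Union>i\<le>1. \<Union>U\<in>\<U> i. U) = UNIV"
  proof -
    have "x \<in> block (2 * (e x div N div 2) + int (nat (e x div N mod 2)))" for x
      unfolding block_def by simp
    moreover have "nat (e x div N mod 2) \<le> 1" for x
      by linarith
    ultimately show ?thesis
      unfolding \<U>_def by blast
  qed
  show "\<exists>\<U> :: nat \<Rightarrow> 'a set set.
      (\<forall>i\<le>1. \<forall>U\<in>\<U> i. U \<subseteq> mspace (line_metric e)) \<and>
      mspace (line_metric e) = (\<Union>i\<le>1. \<Union>U\<in>\<U> i. U) \<and>
      (\<forall>i\<le>1. \<forall>U\<in>\<U> i. \<forall>V\<in>\<U> i. U \<noteq> V \<longrightarrow> set_distance (line_metric e) U V > ennreal R) \<and>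
      (\<forall>i\<le>1. (SUP U\<in>\<U> i. set_diameter (line_metric e) U) < \<infinity>)"
    using assms sep diam cover by (intro exI[of _ \<U>]) (simp add: mspace_line_metric)
qed

lemma asydim_line_metric:
  assumes "inj e" and half_line: "{0..} \<subseteq> range e"
  shows "asydim (line_metric e) = 1"
proof (rule asydim_eq_1I)
  show "asydim_le (line_metric e) 1"
    by (rule asydim_le_1_line_metric) fact
  have e_inv: "e (inv e i) = i" if "i \<ge> 0" for i
    using half_line that by (intro f_inv_into_f) auto
  show "\<not> asydim_le (line_metric e) 0"
  proof (rule unbounded_walk_not_asydim_le_0[of "\<lambda>n. inv e (int n)" _ 1])
    fix C :: real
    show "\<exists>n. C < mdist (line_metric e) (inv e (int 0)) (inv e (int n))"
      using reals_Archimedean2[of C] by (simp add: mdist_line_metric[OF assms(1)] e_inv)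
  qed (simp_all add: mspace_line_metric[OF assms(1)] mdist_line_metric[OF assms(1)] e_inv)
qed

section \<open>Folding a line onto a half-line\<close>

text \<open>\<^const>\<open>int_decode\<close> lists the integers as \<open>0, -1, 1, -2, 2, \<dots>\<close>, so neighbouring
  integers of equal sign are two positions apart. The additive constant accounts for the passage
  between the signs.\<close>

lemma int_decode_fold: "\<bar>int m - int n\<bar> \<le> 2 * \<bar>int_decode m - int_decode n\<bar> + 1"
  by (auto simp: int_decode_def sum_decode_def abs_if elim!: evenE oddE)

lemma coarse_fold: "coarse_map (line_metric int_decode) (line_metric int) id"
proof -
  have "real_of_int \<bar>int m - int n\<bar> \<le> 2 * r + 1"
    if "real_of_int \<bar>int_decode m - int_decode n\<bar> \<le> r" for m n r
  proof -
    have "real_of_int \<bar>int m - int n\<bar> \<le> real_of_int (2 * \<bar>int_decode m - int_decode n\<bar> + 1)"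
      using int_decode_fold by (simp only: of_int_le_iff)
    with that show ?thesis by simp
  qed
  then show ?thesis
    unfolding coarse_map_iff mdist_line_metric[OF inj_int_decode] mdist_line_metric[OF inj_of_nat]
    by (metis id_apply)
qed

text \<open>A discrete intermediate value theorem: the first value above \<open>v\<close> overshoots by at most
  one jump.\<close>

lemma crosses_window:
  fixes p :: "nat \<Rightarrow> nat"
  assumes "p 0 \<le> v" and jump: "\<And>k. p (Suc k) \<le> p k + L" and "p k > v"
  obtains n where "v < p n" "p n \<le> v + L"
proof -
  define n where "n = (LEAST n. p n > v)"
  have n: "p n > v"
    unfolding n_def using \<open>p k > v\<close> by (rule LeastI)
  then obtain m where m: "n = Suc m"
    using \<open>p 0 \<le> v\<close> by (cases n) auto
  have "\<not> p m > v"
    by (rule not_less_Least) (fold n_def, simp add: m)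
  then have "p n \<le> v + L"
    using jump[of m] m by simp
  with n that show thesis by blast
qed

lemma unbounded_if_separated:
  fixes p :: "nat \<Rightarrow> nat"
  assumes far: "\<And>m n. m + s \<le> n \<Longrightarrow> p m \<noteq> p n"
  shows "\<exists>k. p k > v"
proof (rule ccontr)
  assume "\<nexists>k. p k > v"
  then have "range (\<lambda>j. p (Suc s * j)) \<subseteq> {..v}"
    by (auto simp: not_less)
  then have "finite (range (\<lambda>j. p (Suc s * j)))"
    by (rule finite_subset) simp
  moreover have "inj (\<lambda>j. p (Suc s * j))"
  proof (rule linorder_injI)
    fix i j :: nat assume "i < j"
    then have "Suc s * Suc i \<le> Suc s * j"
      by (intro mult_le_mono2) simp
    then show "p (Suc s * i) \<noteq> p (Suc s * j)"
      by (intro far) simp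
  qed
  ultimately show False
    using finite_imageD[of "\<lambda>j. p (Suc s * j)" UNIV] by simp
qed

lemma no_coarse_embedding_line_into_half_line:
  "\<not> coarse_embedding (line_metric int_decode) (line_metric int) f"
proof
  define h where "h i = f (int_encode i)" for i
  assume "coarse_embedding (line_metric int_decode) (line_metric int) f"
  then have coarse: "coarse_map (line_metric int_decode) (line_metric int) f"
    and expanding: "expanding_map (line_metric int_decode) (line_metric int) f"
    unfolding coarse_embedding_def by auto
  have carrier: "x \<in> mspace (line_metric int_decode)" for x
    by (simp add: mspace_line_metric inj_int_decode)
  have dist_dom: "mdist (line_metric int_decode) (int_encode i) (int_encode j) = real_of_int \<bar>i - j\<bar>"
    and dist_cod: "mdist (line_metric int) (f (int_encode i)) (f (int_encode j)) =
      real_of_int \<bar>int (h i) - int (h j)\<bar>" for i j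
    by (simp_all add: mdist_line_metric inj_int_decode h_def)
  obtain C where C: "\<And>i j. \<bar>i - j\<bar> \<le> 1 \<Longrightarrow> real_of_int \<bar>int (h i) - int (h j)\<bar> \<le> C"
  proof -
    obtain C where le_C: "\<forall>x y. mdist (line_metric int_decode) x y \<le> 1 \<longrightarrow>
        mdist (line_metric int) (f x) (f y) \<le> C"
      using coarse carrier unfolding coarse_map_iff by (meson zero_less_one)
    then have "real_of_int \<bar>int (h i) - int (h j)\<bar> \<le> C" if "\<bar>i - j\<bar> \<le> 1" for i j
    proof -
      have "mdist (line_metric int_decode) (int_encode i) (int_encode j) \<le> 1"
        using that unfolding dist_dom by simp
      with le_C show ?thesis unfolding dist_cod[symmetric] by blast
    qed
    with that show thesis by blast
  qed
  define L where "L = nat \<lceil>C\<rceil>"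
  have jump: "h j \<le> h i + L" if "\<bar>i - j\<bar> \<le> 1" for i j
    using C[OF that] unfolding L_def by linarith
  obtain s where "\<And>x y. mdist (line_metric int_decode) x y \<ge> real s \<Longrightarrow>
      mdist (line_metric int) (f x) (f y) > real L"
    using expanding_mapD[OF expanding, of "real L"] carrier by metis
  then have far: "\<bar>int (h i) - int (h j)\<bar> > int L" if "\<bar>i - j\<bar> \<ge> int s" for i j
    using that dist_dom[of i j] dist_cod[of i j] by (metis of_int_le_iff of_int_less_iff of_int_of_nat_eq)
  define p q where "p n = h (int n)" and "q n = h (- int n)" for n
  \<comment> \<open>The window lies above the images of \<open>0, \<dots>, s\<close>, so that the right end of the line reaches it
    only beyond \<open>s\<close>.\<close>
  define v where "v = Max (p ` {..s})"
  have v: "p k \<le> v" if "k \<le> s" for k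
    unfolding v_def using that by (intro Max_ge) auto
  have "p m \<noteq> p n" "q m \<noteq> q n" if "m + s \<le> n" for m n
    using that far[of "int m" "int n"] far[of "- int m" "- int n"] unfolding p_def q_def by auto
  then obtain k l where k: "p k > v" and l: "q l > v"
    using unbounded_if_separated[of s p v] unbounded_if_separated[of s q v] by blast
  have start: "p 0 \<le> v" "q 0 \<le> v"
    using v[of 0] by (simp_all add: p_def q_def)
  obtain n where n: "v < p n" "p n \<le> v + L"
    using crosses_window[OF start(1) _ k, of L] jump unfolding p_def by auto
  obtain m where m: "v < q m" "q m \<le> v + L"
    using crosses_window[OF start(2) _ l, of L] jump unfolding q_def by auto
  have "n > s"
    using n(1) v[of n] by (cases "n \<le> s") auto
  then have "\<bar>int (p n) - int (q m)\<bar> > int L"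
    using far[of "int n" "- int m"] unfolding p_def q_def by auto
  with n m show False by linarith
qed

theorem proposition2p4:
  shows "\<exists>(X :: nat metric) (Y :: nat metric).
    uniformly_locally_finite X \<and> uniformly_locally_finite Y \<and>
    asydim X = 1 \<and> asydim Y = 1 \<and>
    (\<exists>\<Phi>. Roe_embedding X Y \<Phi> \<and> strongly_continuous X \<Phi> \<and> rank_preserving X \<Phi>) \<and>
    \<not> (\<exists>f. coarse_embedding X Y f)"
proof (rule exI[of _ "line_metric int_decode"], rule exI[of _ "line_metric int"], intro conjI)
  let ?X = "line_metric int_decode" and ?Y = "line_metric int"
  show "uniformly_locally_finite ?X" "uniformly_locally_finite ?Y"
    by (intro uniformly_locally_finite_line_metric inj_int_decode inj_of_nat)+
  show "asydim ?X = 1"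
    by (intro asydim_line_metric inj_int_decode) (simp add: surj_int_decode)
  show "asydim ?Y = 1"
    by (intro asydim_line_metric inj_of_nat) (auto elim!: nonneg_int_cases)
  show "\<exists>\<Phi>. Roe_embedding ?X ?Y \<Phi> \<and> strongly_continuous ?X \<Phi> \<and> rank_preserving ?X \<Phi>"
  proof (intro exI[of _ id] conjI)
    show "Roe_embedding ?X ?Y id"
      by (intro Roe_embedding_id coarse_fold)
        (simp add: mspace_line_metric inj_int_decode)
  qed (simp_all add: strongly_continuous_def rank_preserving_def)
  show "\<not> (\<exists>f. coarse_embedding ?X ?Y f)"
    by (simp add: no_coarse_embedding_line_into_half_line)
qed

end
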